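(* Consider the scalar event-triggered control system described in the context, with $A>0$, $B\ne0$, delay bound $\gamma$, triggering function $v(t)=v_0e^{-\sigma t}$ ($v_0,\sigma>0$), and design parameter $0<\rho_0<1$. If the requirement $$|z(t_c^{k+})|=|z(t_c^k)-\bar z(t_c^k)|\le \rho(t_s^k):=\rho_0e^{-\sigma\gamma}v(t_s^k)\quad\text{(for all } t_c^k\in[t_s^k,t_s^k+\gamma])$$ holds with $\nu$-precision for all $k\in\mathbb{N}$, then there exist a delay realization $\{\Delta_k\}_{k\in\mathbb{N}}$ and an initial condition such that the information transmission rate satisfies $$R_s\ \ge\ \frac{A+\sigma}{\ln\nu+\ln\left(2+\frac{e^{\sigma\gamma}}{\rho_0}\right)}\ \max\left\{0,\ \log\frac{e^{A\gamma}-1}{\rho_0e^{-\sigma\gamma}}\right\}.$$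
   Context: $\log$ is the logarithm to base $2$, $\ln$ the natural logarithm, $\mathbb{N}$ the positive integers, $f(t^+)$ the right limit of $f$ at $t$, and $m$ Lebesgue measure. Plant and channel. $\dot x(t)=Ax(t)+Bu(t)$, $x(t),u(t)\in\mathbb{R}$, $A>0$, $B\ne 0$ real, $|x(0)|<L$ with $L$ known to sensor and controller. The sensor measures $x$ exactly. At times $t_s^k$ ($k\in\mathbb{N}$) the sensor transmits a packet of $g(t_s^k)$ bits, received by the controller without error at time $t_c^k$; the communication delay $\Delta_k=t_c^k-t_s^k$ is unknown and satisfies $0\le\Delta_k\le\gamma$, with $\gamma$ known to both. Triggering intervals: $\Delta'_k=t_s^{k+1}-t_s^k$. The superscript $k$ is dropped for a generic triggering or reception time. Estimator and triggering. Between receptions the controller's estimate obeys $\dot{\hat x}=A\hat x+Bu$; the sensor can also compute $\hat x$. The state estimation error is $z=x-\hat x$. With the event-triggering function $v(t)=v_0e^{-\sigma t}$, a transmission occurs whenever $|z(t)|=v(t)$. On reception the estimate jumps: $\hat x(t_c^+)=\bar z(t_c)+\hat x(t_c)$, where $\bar z(t_c)$ is an estimate of $z(t_c)$ constructed by the controller from the knowledge that $|z(t_s)|=v(t_s)$, the delay bound, and the received packet. Hence $z(t_c^+)=z(t_c)-\bar z(t_c)$. $\nu$-precision assumption. Let $\beta=\frac1A\ln(1+2\rho_0e^{-\sigma\gamma})$. There exist a delay realization $\{\Delta_k\le\beta\}_{k\in\mathbb{N}}$, an initial condition $x(0)$, and a real number $\nu\ge1$ such that $|z(t_c^k)-\bar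 z(t_c^k)|\ge\rho(t_s^k)/\nu$ for all $k\in\mathbb{N}$. Information transmission rate: $R_s=\limsup_{N\to\infty}\dfrac{\sum_{k=1}^N g(t_s^k)}{\sum_{k=1}^N\Delta'_k}$. Packet size. The sensor does not know the delay; its uncertainty set about $z(t_c)$ given $t_s$ is $\Omega(z(t_c)|t_s)=\{y:\ y=\pm v(t_s)e^{A(t_c-t_s)},\ t_c\in[t_s,t_s+\gamma]\}$. A packet of $g(t_s)\ge0$ bits can single out one of $2^{g(t_s)}$ balls, and to guarantee the requirement $|z(t_c^+)|\le\rho(t_s)$ the packet sent at $t_s$ must allow $\Omega(z(t_c)|t_s)$ to be covered by $2^{g(t_s)}$ one-dimensional balls of radius $\rho(t_s)$. *)

theory Defs
  imports "HOL-Analysis.Analysis"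
begin

text \<open>
  Packets are bit strings, so the packet size \<open>g(t\<^sub>s)\<close> is the length of the packet.  What a party
  knows about past receptions at some time is the set of pairs (reception time, received packet).
\<close>

type_synonym receptions = "(real \<times> bool list) set"

text \<open>
  A communication and control scheme.  The controller's initial estimate is common knowledge.
  The encoder chooses the packet from the triggering time, the state trajectory observed so far,
  and the past receptions (the sensor can compute the estimate); it does not see the delay of the
  packet being sent.  The decoder constructs the estimate of the estimation error from the reception time
  and all receptions up to and including the current one; the triggering rule, the delay bound and
  the other constants are fixed, so they need not be arguments.  The control law only uses the
  current time and the receptions strictly in the past, which also determine the estimate.
\<close>

record scheme =
  init_est :: real
  encode :: "real \<Rightarrow> (real \<Rightarrow> real) \<Rightarrow> receptions \<Rightarrow> bool list"
  decode :: "real \<Rightarrow> receptions \<Rightarrow> real"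
  control :: "real \<Rightarrow> receptions \<Rightarrow> real"

text \<open>
  Trajectories on \<open>t \<ge> 0\<close>, and triggering times, reception times, packets and estimates
  of the error for the successive transmissions.  Transmissions are numbered from 0.
\<close>

record execution =
  state :: "real \<Rightarrow> real"
  est :: "real \<Rightarrow> real"
  inp :: "real \<Rightarrow> real"
  t_s :: "nat \<Rightarrow> real"
  t_c :: "nat \<Rightarrow> real"
  packet :: "nat \<Rightarrow> bool list"
  err_est :: "nat \<Rightarrow> real"

definition err :: "execution \<Rightarrow> real \<Rightarrow> real" where
  "err e t = state e t - est e t"

definition trig_fun :: "real \<Rightarrow> real \<Rightarrow> real \<Rightarrow> real" where
  "trig_fun v0 \<sigma> t = v0 * exp (- \<sigma> * t)"

definition prec :: "real \<Rightarrow> real \<Rightarrow> real \<Rightarrow> real \<Rightarrow> real \<Rightarrow> real" where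
  "prec \<rho>0 \<gamma> v0 \<sigma> t = \<rho>0 * exp (- \<sigma> * \<gamma>) * trig_fun v0 \<sigma> t"

definition delays :: "real \<Rightarrow> (nat \<Rightarrow> real) \<Rightarrow> bool" where
  "delays \<gamma> \<Delta> \<longleftrightarrow> (\<forall>k. 0 \<le> \<Delta> k \<and> \<Delta> k \<le> \<gamma>)"

definition received_before :: "execution \<Rightarrow> real \<Rightarrow> receptions" where
  "received_before e t = {(t_c e i, packet e i) | i. t_c e i < t}"

definition received_upto :: "execution \<Rightarrow> real \<Rightarrow> receptions" where
  "received_upto e t = {(t_c e i, packet e i) | i. t_c e i \<le> t}"

text \<open>
  \<open>is_execution A B v0 \<sigma> S \<Delta> x0 e\<close>: under the scheme \<open>S\<close>, the delay realization \<open>\<Delta>\<close> and the initial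
  condition \<open>x0\<close>, the closed loop evolves as \<open>e\<close>, with infinitely many transmissions.
  The differential equations hold off the reception times, where the control may be discontinuous
  and the estimate jumps.  The value of the estimate at a reception time is the one before the
  jump.  At \<open>t = 0\<close> the derivative is one-sided.
\<close>

definition is_execution ::
  "real \<Rightarrow> real \<Rightarrow> real \<Rightarrow> real \<Rightarrow> scheme \<Rightarrow> (nat \<Rightarrow> real) \<Rightarrow> real \<Rightarrow> execution \<Rightarrow> bool" where
  "is_execution A B v0 \<sigma> S \<Delta> x0 e \<longleftrightarrow>
     state e 0 = x0 \<and> est e 0 = init_est S \<and>
     continuous_on {0..} (state e) \<and>
     (\<forall>t\<ge>0. t \<notin> range (t_c e) \<longrightarrow>
        (state e has_real_derivative A * state e t + B * inp e t) (at t within {0..}) \<and>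
        (est e has_real_derivative A * est e t + B * inp e t) (at t within {0..})) \<and>
     (\<forall>k. continuous (at (t_c e k) within {0..t_c e k}) (est e) \<and>
          (est e \<longlongrightarrow> err_est e k + est e (t_c e k)) (at_right (t_c e k))) \<and>
     (\<forall>t\<ge>0. inp e t = control S t (received_before e t)) \<and>
     strict_mono (t_s e) \<and>
     range (t_s e) = {t. 0 \<le> t \<and> \<bar>err e t\<bar> = trig_fun v0 \<sigma> t} \<and>
     (\<forall>k. t_c e k = t_s e k + \<Delta> k) \<and>
     (\<forall>k. packet e k =
            encode S (t_s e k) (restrict (state e) {0..t_s e k}) (received_before e (t_s e k))) \<and>
     (\<forall>k. err_est e k = decode S (t_c e k) (received_upto e (t_c e k)))"

definition requirement ::
  "real \<Rightarrow> real \<Rightarrow> real \<Rightarrow> real \<Rightarrow> real \<Rightarrow> real \<Rightarrow> real \<Rightarrow> scheme \<Rightarrow> bool" where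
  "requirement A B L \<gamma> v0 \<sigma> \<rho>0 S \<longleftrightarrow>
     (\<forall>\<Delta> x0 e. delays \<gamma> \<Delta> \<longrightarrow> \<bar>x0\<bar> < L \<longrightarrow> is_execution A B v0 \<sigma> S \<Delta> x0 e \<longrightarrow>
        (\<forall>k. \<bar>err e (t_c e k) - err_est e k\<bar> \<le> prec \<rho>0 \<gamma> v0 \<sigma> (t_s e k)))"

definition \<beta> :: "real \<Rightarrow> real \<Rightarrow> real \<Rightarrow> real \<Rightarrow> real" where
  "\<beta> A \<gamma> \<sigma> \<rho>0 = 1 / A * ln (1 + 2 * \<rho>0 * exp (- \<sigma> * \<gamma>))"

definition nu_precision ::
  "real \<Rightarrow> real \<Rightarrow> real \<Rightarrow> real \<Rightarrow> real \<Rightarrow> real \<Rightarrow> real \<Rightarrow> real \<Rightarrow> scheme \<Rightarrow> bool" where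
  "nu_precision \<nu> A B L \<gamma> v0 \<sigma> \<rho>0 S \<longleftrightarrow>
     1 \<le> \<nu> \<and>
     (\<exists>\<Delta> x0 e. delays \<gamma> \<Delta> \<and> (\<forall>k. \<Delta> k \<le> \<beta> A \<gamma> \<sigma> \<rho>0) \<and> \<bar>x0\<bar> < L \<and>
        is_execution A B v0 \<sigma> S \<Delta> x0 e \<and>
        (\<forall>k. \<bar>err e (t_c e k) - err_est e k\<bar> \<ge> prec \<rho>0 \<gamma> v0 \<sigma> (t_s e k) / \<nu>))"

definition uncertainty :: "real \<Rightarrow> real \<Rightarrow> real \<Rightarrow> real \<Rightarrow> real \<Rightarrow> real set" where
  "uncertainty A \<gamma> v0 \<sigma> ts =
     {y. \<exists>tc\<in>{ts..ts + \<gamma>}. y = trig_fun v0 \<sigma> ts * exp (A * (tc - ts)) \<or>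
                          y = - (trig_fun v0 \<sigma> ts * exp (A * (tc - ts)))}"

text \<open>
  The packet size has to be sufficient for the sensor, which does not know the delay, to cover its
  uncertainty set by \<open>2 ^ g\<close> balls.  The set \<open>C\<close> holds the centres of the balls, which are
  closed because the bound on the error in the requirement is not strict.
\<close>

definition packets_cover ::
  "real \<Rightarrow> real \<Rightarrow> real \<Rightarrow> real \<Rightarrow> real \<Rightarrow> real \<Rightarrow> real \<Rightarrow> scheme \<Rightarrow> bool" where
  "packets_cover A B L \<gamma> v0 \<sigma> \<rho>0 S \<longleftrightarrow>
     (\<forall>\<Delta> x0 e. delays \<gamma> \<Delta> \<longrightarrow> \<bar>x0\<bar> < L \<longrightarrow> is_execution A B v0 \<sigma> S \<Delta> x0 e \<longrightarrow>
        (\<forall>k. \<exists>C. card C = 2 ^ length (packet e k) \<and>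
               uncertainty A \<gamma> v0 \<sigma> (t_s e k) \<subseteq> (\<Union>c\<in>C. cball c (prec \<rho>0 \<gamma> v0 \<sigma> (t_s e k)))))"

text \<open>The rate is an extended real, since the limit superior may be infinite.\<close>

definition rate :: "execution \<Rightarrow> ereal" where
  "rate e = limsup (\<lambda>N. ereal ((\<Sum>k<N. real (length (packet e k))) /
                              (\<Sum>k<N. t_s e (Suc k) - t_s e k)))"

end

theory Submission
  imports Defs
begin

text \<open>
  Comparing Lebesgue measures, \<open>2 ^ g\<close> balls of radius \<open>\<rho>\<close> cover the uncertainty set only if
  \<open>2 ^ g \<ge> (exp (A * \<gamma>) - 1) / (\<rho>0 * exp (- \<sigma> * \<gamma>))\<close>, which bounds every packet size from below.
  In the execution provided by \<open>\<nu>\<close>-precision, the error right after a reception is at least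
  \<open>\<rho> / \<nu>\<close> and then grows like \<open>exp (A * t)\<close> until it meets the decaying triggering function.
  Since the delay is at most \<open>\<beta>\<close>, this bounds every triggering interval from above by
  \<open>(ln \<nu> + ln (2 + exp (\<sigma> * \<gamma>) / \<rho>0)) / (A + \<sigma>)\<close>.  The rate is at least the quotient of the bounds.
\<close>

section \<open>Exponential growth between one-sided limits\<close>

text \<open>The product \<open>z t * exp (- (A * t))\<close> has zero derivative inside the
  interval, so its limits at both ends agree. One-sided limits replace values at the endpoints
  because the estimate, and with it the error, may jump there.\<close>

lemma linear_ode_one_sided_limits:
  fixes z :: "real \<Rightarrow> real"
  assumes "a < b"
    and deriv: "\<And>t. \<lbrakk>a < t; t < b\<rbrakk> \<Longrightarrow> (z has_real_derivative A * z t) (at t)"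
    and right: "(z \<longlongrightarrow> za) (at_right a)"
    and left: "(z \<longlongrightarrow> zb) (at_left b)"
  shows "zb = za * exp (A * (b - a))"
proof -
  define w where "w t = z t * exp (- (A * t))" for t
  have "(w has_field_derivative 0) (at t within {a<..<b})" if "t \<in> {a<..<b}" for t
    unfolding w_def
    using that by (auto intro!: derivative_eq_intros has_field_derivative_at_within[OF deriv])
  then obtain c where c: "\<And>t. t \<in> {a<..<b} \<Longrightarrow> w t = c"
    using has_field_derivative_zero_constant[of "{a<..<b}" w] by auto
  have "(w \<longlongrightarrow> c) (at_right a)"
    using c \<open>a < b\<close> by (intro tendsto_eventually eventually_at_rightI[of a b]) auto
  moreover have "(w \<longlongrightarrow> za * exp (- (A * a))) (at_right a)"
    unfolding w_def by (intro tendsto_intros right)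
  ultimately have ca: "c = za * exp (- (A * a))"
    by (rule tendsto_unique[OF trivial_limit_at_right_real])
  have "(w \<longlongrightarrow> c) (at_left b)"
    using c \<open>a < b\<close> by (intro tendsto_eventually eventually_at_leftI[of a b]) auto
  moreover have "(w \<longlongrightarrow> zb * exp (- (A * b))) (at_left b)"
    unfolding w_def by (intro tendsto_intros left)
  ultimately have "c = zb * exp (- (A * b))"
    by (rule tendsto_unique[OF trivial_limit_at_left_real])
  with ca show ?thesis
    by (simp add: exp_minus exp_diff right_diff_distrib field_simps)
qed

section \<open>Error dynamics and triggering intervals of one execution\<close>

context
  fixes A B v0 \<sigma> x0 :: real and S :: scheme and \<Delta> :: "nat \<Rightarrow> real" and e :: execution
  assumes exec: "is_execution A B v0 \<sigma> S \<Delta> x0 e"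
    and pos: "A > 0" "v0 > 0" "\<sigma> > 0"
    and delay_nonneg: "\<And>k. 0 \<le> \<Delta> k"
begin

lemma triggered: "0 \<le> t_s e k" "\<bar>err e (t_s e k)\<bar> = trig_fun v0 \<sigma> (t_s e k)"
proof -
  have "t_s e k \<in> {t. 0 \<le> t \<and> \<bar>err e t\<bar> = trig_fun v0 \<sigma> t}"
    using exec unfolding is_execution_def by (metis rangeI)
  then show "0 \<le> t_s e k" "\<bar>err e (t_s e k)\<bar> = trig_fun v0 \<sigma> (t_s e k)" by auto
qed

lemma t_c_eq: "t_c e k = t_s e k + \<Delta> k"
  using exec unfolding is_execution_def by blast

lemma t_s_less_iff: "t_s e i < t_s e j \<longleftrightarrow> i < j" and t_s_le_iff: "t_s e i \<le> t_s e j \<longleftrightarrow> i \<le> j"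
  using exec unfolding is_execution_def by (auto simp: strict_mono_less strict_mono_less_eq)

text \<open>State and estimate are driven by the same input, so the terms \<open>B * inp e t\<close>
  cancel.\<close>

lemma err_deriv_within:
  assumes "0 \<le> t" "t \<notin> range (t_c e)"
  shows "(err e has_real_derivative A * err e t) (at t within {0..})"
proof -
  have "(state e has_real_derivative A * state e t + B * inp e t) (at t within {0..})"
    "(est e has_real_derivative A * est e t + B * inp e t) (at t within {0..})"
    using exec assms unfolding is_execution_def by blast+
  then show ?thesis
    unfolding err_def by (auto intro!: derivative_eq_intros simp: algebra_simps)
qed

text \<open>This includes reception times: there the estimate takes its value before the jump, which
  makes it left-continuous.\<close>

lemma err_tendsto_left:
  assumes "0 < t"
  shows "(err e \<longlongrightarrow> err e t) (at_left t)"
proof (cases "t \<in> range (t_c e)")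
  case True
  have "continuous_on {0..} (state e)"
    using exec unfolding is_execution_def by blast
  then have "(state e \<longlongrightarrow> state e t) (at t within {0..t})"
    using assms unfolding continuous_on_def by (auto intro: tendsto_within_subset[where S = "{0..}"])
  moreover have "(est e \<longlongrightarrow> est e t) (at t within {0..t})"
    using exec True unfolding is_execution_def continuous_within by blast
  ultimately have "(err e \<longlongrightarrow> err e t) (at t within {0..t})"
    unfolding err_def by (rule tendsto_diff)
  then show ?thesis
    using assms by (simp add: at_within_Icc_at_left)
next
  case False
  then have "(err e \<longlongrightarrow> err e t) (at t within {0..})"
    using DERIV_continuous[OF err_deriv_within] assms by (simp add: continuous_within)
  then have "(err e \<longlongrightarrow> err e t) (at t within {0..t})"
    by (rule tendsto_within_subset) auto
  then show ?thesis
    using assms by (simp add: at_within_Icc_at_left)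
qed

lemma err_tendsto_right:
  assumes "0 \<le> t" "t \<notin> range (t_c e)"
  shows "(err e \<longlongrightarrow> err e t) (at_right t)"
  using DERIV_continuous[OF err_deriv_within[OF assms]] assms(1)
  unfolding continuous_within by (auto intro: tendsto_within_subset)

text \<open>The limit is the error after the jump, while \<open>err e (t_c e k)\<close> is still the
  error before it.\<close>

lemma err_tendsto_after_reception:
  "(err e \<longlongrightarrow> err e (t_c e k) - err_est e k) (at_right (t_c e k))"
proof -
  have "0 \<le> t_c e k"
    using triggered(1)[of k] delay_nonneg[of k] by (simp add: t_c_eq)
  moreover have "continuous_on {0..} (state e)"
    using exec unfolding is_execution_def by blast
  ultimately have "(state e \<longlongrightarrow> state e (t_c e k)) (at_right (t_c e k))"
    unfolding continuous_on_def by (auto intro: tendsto_within_subset)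
  moreover have "(est e \<longlongrightarrow> err_est e k + est e (t_c e k)) (at_right (t_c e k))"
    using exec unfolding is_execution_def by blast
  ultimately show ?thesis
    unfolding err_def by (auto dest: tendsto_diff simp: algebra_simps)
qed

text \<open>Only the open interval has to be free of receptions: a jump at \<open>a\<close> is
  absorbed into the limit \<open>za\<close>, and a jump at \<open>b\<close> does not affect the left
  limit \<open>err e b\<close>.\<close>

lemma err_growth:
  assumes "0 \<le> a" "a < b" "\<And>i. \<not> (a < t_c e i \<and> t_c e i < b)"
    and "(err e \<longlongrightarrow> za) (at_right a)"
  shows "err e b = za * exp (A * (b - a))"
proof (rule linear_ode_one_sided_limits[OF assms(2) _ assms(4)])
  show "(err e \<longlongrightarrow> err e b) (at_left b)"
    using assms by (intro err_tendsto_left) simp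
  fix t assume t: "a < t" "t < b"
  then have "t \<notin> range (t_c e)" using assms(3) by auto
  with t show "(err e has_real_derivative A * err e t) (at t)"
    using has_field_derivative_subset[OF err_deriv_within, of t "{a<..<b}"] assms(1)
    by (simp add: at_within_open[of t "{a<..<b}"] subset_iff)
qed

text \<open>
  Without a reception after a trigger, the error outgrows the decaying triggering function, so
  there is no further trigger.
\<close>

lemma received_before_next_trigger: "t_c e k < t_s e (Suc k)"
\<comment> \<open>The hypothesis for smaller indices rules out that an older packet is still in
  transit at trigger \<open>k\<close>.\<close>
proof (induction k rule: less_induct)
  case (less k)
  show ?case
  proof (rule ccontr)
    assume *: "\<not> ?case"
    \<comment> \<open>The left endpoint is included, since right continuity of the error at
      \<open>t_s e k\<close> requires that no packet arrives at that instant.\<close>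
    have no_rec: "\<not> (t_s e k \<le> t_c e i \<and> t_c e i < t_s e (Suc k))" for i
    proof (cases "i < k")
      case True
      then have "t_c e i < t_s e k"
        using less.IH[of i] t_s_le_iff[of "Suc i" k] by simp
      then show ?thesis by simp
    next
      case False
      show ?thesis
      proof (cases "i = k")
        case True
        with * show ?thesis by simp
      next
        case neq: False
        then have "t_s e (Suc k) \<le> t_c e i"
          using False t_s_le_iff[of "Suc k" i] delay_nonneg[of i] by (simp add: t_c_eq)
        then show ?thesis by simp
      qed
    qed
    have lt: "t_s e k < t_s e (Suc k)" by (simp add: t_s_less_iff)
    have "err e (t_s e (Suc k)) = err e (t_s e k) * exp (A * (t_s e (Suc k) - t_s e k))"
      using no_rec lt triggered(1)[of k]
      by (intro err_growth err_tendsto_right) (auto simp: less_imp_le)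
    then have "trig_fun v0 \<sigma> (t_s e (Suc k)) =
        trig_fun v0 \<sigma> (t_s e k) * exp (A * (t_s e (Suc k) - t_s e k))"
      using triggered(2)[of k] triggered(2)[of "Suc k"] by (simp add: abs_mult)
    moreover have "trig_fun v0 \<sigma> (t_s e (Suc k)) < trig_fun v0 \<sigma> (t_s e k)"
      using lt pos by (simp add: trig_fun_def)
    moreover have "trig_fun v0 \<sigma> (t_s e k) \<le>
        trig_fun v0 \<sigma> (t_s e k) * exp (A * (t_s e (Suc k) - t_s e k))"
      using lt pos by (simp add: trig_fun_def)
    ultimately show False by simp
  qed
qed

text \<open>Packets up to \<open>k\<close> have arrived by \<open>t_c e k\<close>, and later ones
  are sent no earlier than the next trigger. Hence the error grows freely from its value after the
  jump until it meets the triggering function.\<close>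

lemma err_at_next_trigger:
  "trig_fun v0 \<sigma> (t_s e (Suc k)) =
     \<bar>err e (t_c e k) - err_est e k\<bar> * exp (A * (t_s e (Suc k) - t_c e k))"
proof -
  have no_rec: "\<not> (t_c e k < t_c e i \<and> t_c e i < t_s e (Suc k))" for i
  proof (cases "i \<le> k")
    case True
    then have "t_c e i \<le> t_c e k"
      using received_before_next_trigger[of i] t_s_le_iff[of "Suc i" k] delay_nonneg[of k]
      by (cases "i = k") (auto simp: t_c_eq)
    then show ?thesis by simp
  next
    case False
    then have "t_s e (Suc k) \<le> t_c e i"
      using t_s_le_iff[of "Suc k" i] delay_nonneg[of i] by (simp add: t_c_eq)
    then show ?thesis by simp
  qed
  have "0 \<le> t_c e k"
    using triggered(1)[of k] delay_nonneg[of k] by (simp add: t_c_eq)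
  then have "err e (t_s e (Suc k)) =
      (err e (t_c e k) - err_est e k) * exp (A * (t_s e (Suc k) - t_c e k))"
    using no_rec received_before_next_trigger
    by (intro err_growth err_tendsto_after_reception) auto
  then show ?thesis
    using triggered(2)[of "Suc k"] by (simp add: abs_mult)
qed

text \<open>With \<open>D\<close> the interval and
  \<open>r = \<rho>0 * exp (- \<sigma> * \<gamma>)\<close>, growth from at least
  \<open>r / \<nu>\<close> times the triggering function at \<open>t_s e k\<close>, during time
  \<open>D - \<Delta> k\<close>, ends at \<open>exp (- \<sigma> * D)\<close> times the same
  quantity. Taking logarithms bounds \<open>(A + \<sigma>) * D\<close>.\<close>

lemma triggering_interval_le:
  assumes "\<rho>0 > 0" "\<nu> \<ge> 1" "\<Delta> k \<le> \<beta> A \<gamma> \<sigma> \<rho>0"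
    and "\<bar>err e (t_c e k) - err_est e k\<bar> \<ge> prec \<rho>0 \<gamma> v0 \<sigma> (t_s e k) / \<nu>"
  shows "t_s e (Suc k) - t_s e k \<le> (ln \<nu> + ln (2 + exp (\<sigma> * \<gamma>) / \<rho>0)) / (A + \<sigma>)"
proof -
  define D where "D = t_s e (Suc k) - t_s e k"
  define r where "r = \<rho>0 * exp (- \<sigma> * \<gamma>)"
  have r: "r > 0" using assms by (simp add: r_def)
  \<comment> \<open>The bound \<open>\<beta>\<close> is the time in which \<open>exp (A * t)\<close>
    reaches \<open>1 + 2 * r\<close>.\<close>
  have "A * \<Delta> k \<le> ln (1 + 2 * r)"
    using assms(3) pos by (simp add: \<beta>_def r_def field_simps)
  have "ln (r / \<nu> * trig_fun v0 \<sigma> (t_s e k) * exp (A * (D - \<Delta> k))) \<le>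
      ln (trig_fun v0 \<sigma> (t_s e (Suc k)))"
  proof (subst ln_le_cancel_iff)
    show "r / \<nu> * trig_fun v0 \<sigma> (t_s e k) * exp (A * (D - \<Delta> k)) \<le> trig_fun v0 \<sigma> (t_s e (Suc k))"
      unfolding err_at_next_trigger[of k] using assms(4)
      by (intro mult_mono) (auto simp: prec_def r_def D_def t_c_eq algebra_simps)
  qed (use r pos assms in \<open>auto simp: trig_fun_def\<close>)
  then have "ln r - ln \<nu> + A * (D - \<Delta> k) \<le> - \<sigma> * D"
    using r pos assms(2) by (simp add: trig_fun_def ln_mult ln_div D_def algebra_simps)
  then have "(A + \<sigma>) * D \<le> ln \<nu> + (ln (1 + 2 * r) - ln r)"
    using \<open>A * \<Delta> k \<le> ln (1 + 2 * r)\<close> by (simp add: algebra_simps)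
  also have "ln (1 + 2 * r) - ln r = ln ((1 + 2 * r) / r)"
    using r by (simp add: ln_div)
  also have "(1 + 2 * r) / r = 2 + exp (\<sigma> * \<gamma>) / \<rho>0"
    using assms(1) by (simp add: r_def exp_minus field_simps)
  finally show ?thesis
    using pos by (simp add: D_def pos_le_divide_eq mult.commute)
qed

end

section \<open>Counting the balls of a cover\<close>

text \<open>The uncertainty set contains two disjoint intervals of length
  \<open>v * (E - 1)\<close>, one for each sign, and each ball has length \<open>2 * r * v\<close>;
  the factor \<open>2 * v\<close> cancels.\<close>

lemma card_cover_uncertainty_ge:
  assumes "v0 > 0" "\<rho>0 > 0" "A > 0" "\<gamma> \<ge> 0" "finite C"
    and cover: "uncertainty A \<gamma> v0 \<sigma> t \<subseteq> (\<Union>c\<in>C. cball c (prec \<rho>0 \<gamma> v0 \<sigma> t))"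
  shows "(exp (A * \<gamma>) - 1) / (\<rho>0 * exp (- \<sigma> * \<gamma>)) \<le> real (card C)"
proof -
  define v where "v = trig_fun v0 \<sigma> t"
  define r where "r = \<rho>0 * exp (- \<sigma> * \<gamma>)"
  define E where "E = exp (A * \<gamma>)"
  have pos: "v > 0" "r > 0" "E \<ge> 1"
    using assms by (auto simp: v_def r_def E_def trig_fun_def)
  \<comment> \<open>Solving for the reception time gives
    \<open>s = t + ln (y / v) / A\<close>.\<close>
  have interval: "\<exists>s\<in>{t..t + \<gamma>}. y = v * exp (A * (s - t))" if "y \<in> {v..v * E}" for y
  proof -
    have y: "y > 0" "1 \<le> y / v" "y / v \<le> E" using that pos by (auto simp: field_simps)
    have "ln (y / v) \<le> A * \<gamma>"
      using y ln_mono[of "y / v" E] by (simp add: E_def)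
    then have "t + ln (y / v) / A \<in> {t..t + \<gamma>}"
      using y assms(3) by (simp add: field_simps)
    moreover have "y = v * exp (A * (t + ln (y / v) / A - t))"
      using y pos assms(3) by simp
    ultimately show ?thesis by blast
  qed
  have "{v..v * E} \<union> {- (v * E).. - v} \<subseteq> uncertainty A \<gamma> v0 \<sigma> t"
  proof
    fix y assume "y \<in> {v..v * E} \<union> {- (v * E).. - v}"
    then have "y \<in> {v..v * E} \<or> - y \<in> {v..v * E}" by auto
    then show "y \<in> uncertainty A \<gamma> v0 \<sigma> t"
    proof
      assume "y \<in> {v..v * E}"
      then show ?thesis using interval[of y] by (auto simp: uncertainty_def v_def)
    next
      assume "- y \<in> {v..v * E}"
      then obtain s where "s \<in> {t..t + \<gamma>}" "- y = v * exp (A * (s - t))"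
        using interval by blast
      then have "s \<in> {t..t + \<gamma>}" "y = - (v * exp (A * (s - t)))" by auto
      then show ?thesis unfolding uncertainty_def v_def by blast
    qed
  qed
  also note cover
  finally have sub: "{v..v * E} \<union> {- (v * E).. - v} \<subseteq> (\<Union>c\<in>C. cball c (r * v))"
    by (simp add: prec_def r_def v_def)
  have vE: "v \<le> v * E" using pos by simp
  have "2 * (v * (E - 1)) = measure lborel {v..v * E} + measure lborel {- (v * E).. - v}"
    using vE by (simp add: algebra_simps)
  also have "\<dots> = measure lborel ({v..v * E} \<union> {- (v * E).. - v})"
    using pos vE by (intro measure_Union[symmetric]) auto
  \<comment> \<open>\<open>measure\<close> is 0 on sets of infinite measure, so monotonicity needs
    the union of balls to have finite measure.\<close>
  also have "\<dots> \<le> measure lborel (\<Union>c\<in>C. cball c (r * v))"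
    using sub assms(5) by (intro measure_mono_fmeasurable fmeasurable.finite_UN)
      (auto intro: fmeasurableI emeasure_lborel_cball_finite)
  also have "\<dots> \<le> (\<Sum>c\<in>C. measure lborel (cball c (r * v)))"
    using assms(5) by (intro measure_UNION_le) auto
  also have "\<dots> = real (card C) * (2 * (r * v))"
    using pos by (simp add: cball_eq_atLeastAtMost)
  finally have "(2 * v) * (E - 1) \<le> (2 * v) * (real (card C) * r)"
    by (simp add: mult_ac)
  then have "E - 1 \<le> real (card C) * r"
    using pos mult_le_cancel_left_pos[of "2 * v"] by simp
  then have "(E - 1) / r \<le> real (card C)"
    using pos by (simp add: pos_divide_le_eq)
  then show ?thesis
    by (simp add: E_def r_def)
qed

section \<open>From bounds on each transmission to the rate\<close>

text \<open>Each quotient with \<open>N > 0\<close> is at least \<open>N * G / (N * T)\<close>. The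
  empty sums at \<open>N = 0\<close> give the default value 0, so the comparison is made only
  eventually.\<close>

lemma limsup_sum_ratio_ge:
  fixes g d :: "nat \<Rightarrow> real"
  assumes "\<And>k. G \<le> g k" "\<And>k. d k \<le> T" "\<And>k. 0 < d k" "0 \<le> G"
  shows "ereal (G / T) \<le> limsup (\<lambda>N. ereal ((\<Sum>k<N. g k) / (\<Sum>k<N. d k)))"
proof -
  have bound: "G / T \<le> (\<Sum>k<N. g k) / (\<Sum>k<N. d k)" if "N > 0" for N
  proof -
    have "N * G \<le> (\<Sum>k<N. g k)"
      using sum_mono[of "{..<N}" "\<lambda>_. G" g] assms(1) by simp
    moreover have "(\<Sum>k<N. d k) \<le> N * T"
      using sum_mono[of "{..<N}" d "\<lambda>_. T"] assms(2) by simp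
    moreover have "0 < (\<Sum>k<N. d k)"
      using that assms(3) by (intro sum_pos) auto
    ultimately have "N * G / (N * T) \<le> (\<Sum>k<N. g k) / (\<Sum>k<N. d k)"
      using assms(1,4) by (intro frac_le sum_nonneg) (auto intro: order_trans)
    then show ?thesis using that by simp
  qed
  have "limsup (\<lambda>N. ereal (G / T)) \<le> limsup (\<lambda>N. ereal ((\<Sum>k<N. g k) / (\<Sum>k<N. d k)))"
    using bound by (intro Limsup_mono eventually_mono[OF eventually_gt_at_top[of 0]]) simp
  then show ?thesis by (simp add: Limsup_const)
qed

theorem theorem2:
  fixes A B L \<gamma> v0 \<sigma> \<rho>0 \<nu> :: real and S :: scheme
  assumes "A > 0" and "B \<noteq> 0" and "\<gamma> \<ge> 0" and "v0 > 0" and "\<sigma> > 0" and "0 < \<rho>0" and "\<rho>0 < 1"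
    and "packets_cover A B L \<gamma> v0 \<sigma> \<rho>0 S"
    and "requirement A B L \<gamma> v0 \<sigma> \<rho>0 S"
    and "nu_precision \<nu> A B L \<gamma> v0 \<sigma> \<rho>0 S"
  shows "\<exists>\<Delta> x0 e. delays \<gamma> \<Delta> \<and> \<bar>x0\<bar> < L \<and> is_execution A B v0 \<sigma> S \<Delta> x0 e \<and>
           rate e \<ge> ereal ((A + \<sigma>) / (ln \<nu> + ln (2 + exp (\<sigma> * \<gamma>) / \<rho>0)) *
                           max 0 (log 2 ((exp (A * \<gamma>) - 1) / (\<rho>0 * exp (- \<sigma> * \<gamma>)))))"
proof -
  \<comment> \<open>The execution provided by \<open>nu_precision\<close> also serves as the witness
    for the rate bound.\<close>
  obtain \<Delta> x0 e where nu: "1 \<le> \<nu>" and del: "delays \<gamma> \<Delta>" "\<And>k. \<Delta> k \<le> \<beta> A \<gamma> \<sigma> \<rho>0"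
    and x0: "\<bar>x0\<bar> < L" and exec: "is_execution A B v0 \<sigma> S \<Delta> x0 e"
    and prec: "\<And>k. \<bar>err e (t_c e k) - err_est e k\<bar> \<ge> prec \<rho>0 \<gamma> v0 \<sigma> (t_s e k) / \<nu>"
    using assms(10) unfolding nu_precision_def by blast
  define T where "T = (ln \<nu> + ln (2 + exp (\<sigma> * \<gamma>) / \<rho>0)) / (A + \<sigma>)"
  define q where "q = (exp (A * \<gamma>) - 1) / (\<rho>0 * exp (- \<sigma> * \<gamma>))"
  have interval_le: "t_s e (Suc k) - t_s e k \<le> T" for k
    unfolding T_def using triggering_interval_le[OF exec] assms nu del prec
    by (simp add: delays_def)
  have interval_pos: "0 < t_s e (Suc k) - t_s e k" for k
    using exec unfolding is_execution_def by (simp add: strict_mono_def)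
  have packet_ge: "max 0 (log 2 q) \<le> real (length (packet e k))" for k
  \<comment> \<open>For zero delay \<open>q = 0\<close>, and the default value
    \<open>ln 0 = 0\<close> makes the maximum 0, as the convention that the logarithm of 0 is minus
    infinity would.\<close>
  proof (cases "\<gamma> = 0")
    case True
    then show ?thesis by (simp add: q_def log_def)
  next
    case False
    obtain C where C: "card C = 2 ^ length (packet e k)"
      "uncertainty A \<gamma> v0 \<sigma> (t_s e k) \<subseteq> (\<Union>c\<in>C. cball c (prec \<rho>0 \<gamma> v0 \<sigma> (t_s e k)))"
      using assms(8)[unfolded packets_cover_def, rule_format, OF del(1) x0 exec] by metis
    \<comment> \<open>An infinite set has \<open>card\<close> 0, which is not a power of 2.\<close>
    have "finite C" using C(1) by (metis card.infinite power_not_zero zero_neq_numeral)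
    then have "q \<le> 2 ^ length (packet e k)"
      using card_cover_uncertainty_ge[OF _ _ _ _ _ C(2)] assms C(1) by (simp add: q_def)
    moreover have "q > 0" using False assms by (simp add: q_def)
    ultimately have "log 2 q \<le> real (length (packet e k))"
      by (simp add: log_le_iff powr_realpow)
    then show ?thesis by simp
  qed
  have "ereal (max 0 (log 2 q) / T) \<le> rate e"
    unfolding rate_def by (rule limsup_sum_ratio_ge[OF packet_ge interval_le interval_pos]) simp
  also have "max 0 (log 2 q) / T =
      (A + \<sigma>) / (ln \<nu> + ln (2 + exp (\<sigma> * \<gamma>) / \<rho>0)) * max 0 (log 2 q)"
    by (simp add: T_def)
  finally have rate_ge: "ereal ((A + \<sigma>) / (ln \<nu> + ln (2 + exp (\<sigma> * \<gamma>) / \<rho>0)) * max 0 (log 2 q)) \<le> rate e" .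
  show ?thesis
    by (rule exI[of _ \<Delta>], rule exI[of _ x0], rule exI[of _ e])
       (intro conjI del(1) x0 exec rate_ge[unfolded q_def])
qed

end
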